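(* Let $\Gamma$ and $\Delta$ be finite nonempty sets, let $K\le\mathrm{Sym}(\Gamma)$ and $L\le\mathrm{Sym}(\Delta)$ be permutation groups, and let $m\ge 2$ be an integer. Then $$(K\uparrow L)^{(m)}\le K^{(m)}\uparrow L^{(m)}$$ unless $m=2$ and $K$ is $2$-transitive. (That is, the inclusion holds whenever it is not the case that both $m=2$ and $K$ is $2$-transitive.)
   Context: For a finite set $\Omega$, a group $G\le\mathrm{Sym}(\Omega)$ and a positive integer $m$, the $m$-closure $G^{(m)}$ is the largest permutation group on $\Omega$ having the same orbits as $G$ in its induced coordinatewise action on the Cartesian power $\Omega^m$. Permutations act on the right, written as exponents. Product action: for $K\le\mathrm{Sym}(\Gamma)$ and $L\le\mathrm{Sym}(\Delta)$ with $\Delta=\{1,\ldots,d\}$, $K\uparrow L$ denotes the permutation group on $\Gamma^d$ induced by the product action of the wreath product $K\wr L$. It consists of the permutations $g=(g_1,\ldots,g_d;\overline g)$ with $g_1,\ldots,g_d\in K$ and $\overline g\in L$, acting on $\omega=(\omega_1,\ldots,\omega_d)\in\Gamma^d$ by $$(\omega^g)_i=(\omega_{j})^{g_{j}},\quad j=i^{\overline g^{-1}},\quad 1\le i\le d.$$ *)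

theory Defs
  imports "HOL-Algebra.Group_Action"
begin

text \<open>
  The symmetric group \<open>Sym(\<Omega>)\<close> is \<^term>\<open>BijGroup \<Omega>\<close>, whose elements are extensional
  bijections of \<open>\<Omega>\<close>, and \<open>G \<le> Sym(\<Omega>)\<close> is \<^term>\<open>subgroup G (BijGroup \<Omega>)\<close>.
  Multiplication in \<^const>\<open>BijGroup\<close> composes from right to left, whereas for permutations acting
  on the right \<open>x\<^sup>g\<^sup>h = (x\<^sup>g)\<^sup>h\<close>. The two products are opposite to each other, so they have the
  same subgroups, orbits and inverses. The image \<open>x\<^sup>g\<close> is written \<^term>\<open>g x\<close>.
\<close>

definition tuples :: "nat \<Rightarrow> 'a set \<Rightarrow> 'a list set" where
  "tuples m \<Omega> = {xs. length xs = m \<and> set xs \<subseteq> \<Omega>}"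

definition tuple_act :: "nat \<Rightarrow> 'a set \<Rightarrow> ('a \<Rightarrow> 'a) \<Rightarrow> 'a list \<Rightarrow> 'a list" where
  "tuple_act m \<Omega> g = (\<lambda>xs \<in> tuples m \<Omega>. map g xs)"

definition tuple_orbits :: "nat \<Rightarrow> 'a set \<Rightarrow> ('a \<Rightarrow> 'a) set \<Rightarrow> 'a list set set" where
  "tuple_orbits m \<Omega> G =
     orbits (BijGroup \<Omega>\<lparr>carrier := G\<rparr>) (tuples m \<Omega>) (tuple_act m \<Omega>)"

definition m_closure :: "nat \<Rightarrow> 'a set \<Rightarrow> ('a \<Rightarrow> 'a) set \<Rightarrow> ('a \<Rightarrow> 'a) set" where
  "m_closure m \<Omega> G =
     (GREATEST H. subgroup H (BijGroup \<Omega>) \<and> tuple_orbits m \<Omega> H = tuple_orbits m \<Omega> G)"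

text \<open>
  The power \<open>\<Gamma>\<^sup>d\<close> is the set of extensional functions \<open>\<Delta> \<rightarrow>\<^sub>E \<Gamma>\<close>, for an arbitrary index set
  \<open>\<Delta>\<close> instead of \<open>{1,\<dots>,d}\<close>. The family \<open>g\<close> and the permutation \<open>h\<close> stand for
  \<open>(g\<^sub>1,\<dots>,g\<^sub>d)\<close> and the top component of \<open>(g\<^sub>1,\<dots>,g\<^sub>d; h)\<close>.
\<close>

definition product_perm ::
  "'a set \<Rightarrow> 'b set \<Rightarrow> ('b \<Rightarrow> 'a \<Rightarrow> 'a) \<Rightarrow> ('b \<Rightarrow> 'b) \<Rightarrow> ('b \<Rightarrow> 'a) \<Rightarrow> ('b \<Rightarrow> 'a)" where
  "product_perm \<Gamma> \<Delta> g h =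
     (\<lambda>\<omega> \<in> \<Delta> \<rightarrow>\<^sub>E \<Gamma>. \<lambda>i \<in> \<Delta>. let j = (inv\<^bsub>BijGroup \<Delta>\<^esub> h) i in g j (\<omega> j))"

definition product_action ::
  "'a set \<Rightarrow> 'b set \<Rightarrow> ('a \<Rightarrow> 'a) set \<Rightarrow> ('b \<Rightarrow> 'b) set \<Rightarrow> (('b \<Rightarrow> 'a) \<Rightarrow> ('b \<Rightarrow> 'a)) set" where
  "product_action \<Gamma> \<Delta> K L = {product_perm \<Gamma> \<Delta> g h | g h. g \<in> \<Delta> \<rightarrow> K \<and> h \<in> L}"

text \<open>
  As usual, a 2-transitive group has degree at least 2.
\<close>

definition two_transitive :: "'a set \<Rightarrow> ('a \<Rightarrow> 'a) set \<Rightarrow> bool" where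
  "two_transitive \<Omega> G \<longleftrightarrow>
     (\<exists>x\<in>\<Omega>. \<exists>y\<in>\<Omega>. x \<noteq> y) \<and>
     (\<forall>x\<in>\<Omega>. \<forall>y\<in>\<Omega>. \<forall>x'\<in>\<Omega>. \<forall>y'\<in>\<Omega>. x \<noteq> y \<longrightarrow> x' \<noteq> y' \<longrightarrow>
        (\<exists>g\<in>G. g x = x' \<and> g y = y'))"

text \<open>
  The following facts show that the largest group in the definition of \<open>m\<close>-closure exists, and
  that \<open>K \<up> L\<close> is a permutation group on the power. In particular, for these groups
  the relation of being a subgroup is set inclusion.
\<close>

lemma Bij_apply: "f \<in> Bij S \<Longrightarrow> x \<in> S \<Longrightarrow> f x \<in> S"
  by (auto simp: Bij_def bij_betw_def)

lemma subgroup_BijD: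
  assumes "subgroup G (BijGroup \<Omega>)"
  shows "G \<subseteq> Bij \<Omega>" "(\<lambda>x\<in>\<Omega>. x) \<in> G"
    "f \<in> G \<Longrightarrow> g \<in> G \<Longrightarrow> compose \<Omega> f g \<in> G"
    "f \<in> G \<Longrightarrow> restrict (inv_into \<Omega> f) \<Omega> \<in> G"
proof -
  show sub: "G \<subseteq> Bij \<Omega>"
    using subgroup.subset[OF assms] by (simp add: BijGroup_def)
  show "(\<lambda>x\<in>\<Omega>. x) \<in> G"
    using subgroup.one_closed[OF assms] by (simp add: BijGroup_def)
  show "compose \<Omega> f g \<in> G" if "f \<in> G" "g \<in> G"
    using subgroup.m_closed[OF assms that] sub that by (simp add: BijGroup_def subset_iff)
  show "restrict (inv_into \<Omega> f) \<Omega> \<in> G" if "f \<in> G"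
    using subgroup.m_inv_closed[OF assms that] sub that by (simp add: inv_BijGroup subset_iff)
qed

lemma subgroup_BijI:
  assumes "G \<subseteq> Bij \<Omega>" "(\<lambda>x\<in>\<Omega>. x) \<in> G"
    "\<And>f g. f \<in> G \<Longrightarrow> g \<in> G \<Longrightarrow> compose \<Omega> f g \<in> G"
    "\<And>f. f \<in> G \<Longrightarrow> restrict (inv_into \<Omega> f) \<Omega> \<in> G"
  shows "subgroup G (BijGroup \<Omega>)"
proof (rule subgroup.intro)
  show "G \<subseteq> carrier (BijGroup \<Omega>)" using assms(1) by (simp add: BijGroup_def)
  show "x \<otimes>\<^bsub>BijGroup \<Omega>\<^esub> y \<in> G" if "x \<in> G" "y \<in> G" for x y
    using assms(1) assms(3)[OF that] that by (simp add: BijGroup_def subset_iff)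
  show "\<one>\<^bsub>BijGroup \<Omega>\<^esub> \<in> G" using assms(2) by (simp add: BijGroup_def)
  show "inv\<^bsub>BijGroup \<Omega>\<^esub> x \<in> G" if "x \<in> G" for x
    using assms(1) assms(4)[OF that] that by (simp add: inv_BijGroup subset_iff)
qed

lemma tuple_orbits_eq:
  "tuple_orbits m \<Omega> G = (\<lambda>xs. (\<lambda>g. map g xs) ` G) ` tuples m \<Omega>"
proof -
  have "orbit (BijGroup \<Omega>\<lparr>carrier := G\<rparr>) (tuple_act m \<Omega>) xs = (\<lambda>g. map g xs) ` G"
    if "xs \<in> tuples m \<Omega>" for xs
    using that by (auto simp: orbit_def tuple_act_def)
  then show ?thesis
    unfolding tuple_orbits_def orbits_def Setcompr_eq_image by (rule image_cong[OF refl])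
qed

lemma map_id_tuple: "xs \<in> tuples m \<Omega> \<Longrightarrow> map (\<lambda>x\<in>\<Omega>. x) xs = xs"
  by (rule map_idI) (auto simp: tuples_def)

lemma map_in_tuples: "f \<in> Bij \<Omega> \<Longrightarrow> xs \<in> tuples m \<Omega> \<Longrightarrow> map f xs \<in> tuples m \<Omega>"
  by (auto simp: tuples_def Bij_apply subset_iff)

lemma map_compose_tuple:
  "xs \<in> tuples m \<Omega> \<Longrightarrow> map (compose \<Omega> f g) xs = map f (map g xs)"
  by (auto simp: tuples_def compose_def subset_iff)

lemma map_inv_tuple:
  "f \<in> Bij \<Omega> \<Longrightarrow> xs \<in> tuples m \<Omega> \<Longrightarrow> map (restrict (inv_into \<Omega> f) \<Omega>) (map f xs) = xs"
  by (simp, rule map_idI) (auto simp: tuples_def Bij_def bij_betw_def subset_iff)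

lemma map_inv_tuple':
  "f \<in> Bij \<Omega> \<Longrightarrow> xs \<in> tuples m \<Omega> \<Longrightarrow> map f (map (restrict (inv_into \<Omega> f) \<Omega>) xs) = xs"
  by (simp, rule map_idI) (auto simp: tuples_def Bij_def bij_betw_def subset_iff f_inv_into_f)

lemma m_closure_eq:
  assumes G: "subgroup G (BijGroup \<Omega>)"
  shows "m_closure m \<Omega> G =
      {f \<in> Bij \<Omega>. \<forall>xs \<in> tuples m \<Omega>. \<exists>g\<in>G. map f xs = map g xs}" (is "_ = ?H")
    and "subgroup (m_closure m \<Omega> G) (BijGroup \<Omega>)"
    and "tuple_orbits m \<Omega> (m_closure m \<Omega> G) = tuple_orbits m \<Omega> G"
    and "\<And>H. subgroup H (BijGroup \<Omega>) \<Longrightarrow> tuple_orbits m \<Omega> H = tuple_orbits m \<Omega> G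
          \<Longrightarrow> H \<subseteq> m_closure m \<Omega> G"
proof -
  note GD = subgroup_BijD[OF G]
  have sub: "subgroup ?H (BijGroup \<Omega>)"
  proof (rule subgroup_BijI)
    show "(\<lambda>x\<in>\<Omega>. x) \<in> ?H" using GD(2) id_Bij by blast
  next
    fix f g assume f: "f \<in> ?H" and g: "g \<in> ?H"
    have "\<exists>k\<in>G. map (compose \<Omega> f g) xs = map k xs" if xs: "xs \<in> tuples m \<Omega>" for xs
    proof -
      obtain b where b: "b \<in> G" "map g xs = map b xs" using g xs by blast
      have "map g xs \<in> tuples m \<Omega>" using g xs by (blast intro: map_in_tuples)
      then obtain a where a: "a \<in> G" "map f (map g xs) = map a (map g xs)" using f by blast
      have "map (compose \<Omega> f g) xs = map (compose \<Omega> a b) xs"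
        using a(2) b(2) map_compose_tuple[OF xs] by metis
      then show ?thesis using GD(3) a b by blast
    qed
    then show "compose \<Omega> f g \<in> ?H" using f g compose_Bij by blast
  next
    fix f assume f: "f \<in> ?H"
    let ?i = "restrict (inv_into \<Omega> f) \<Omega>"
    have fB: "f \<in> Bij \<Omega>" using f by blast
    have iB: "?i \<in> Bij \<Omega>" using fB by (rule restrict_inv_into_Bij)
    have "\<exists>k\<in>G. map ?i xs = map k xs" if xs: "xs \<in> tuples m \<Omega>" for xs
    proof -
      have ys: "map ?i xs \<in> tuples m \<Omega>" using iB xs by (rule map_in_tuples)
      then obtain a where a: "a \<in> G" "map f (map ?i xs) = map a (map ?i xs)" using f by blast
      then have "xs = map a (map ?i xs)" using map_inv_tuple'[OF fB xs] by metis
      then have "map (restrict (inv_into \<Omega> a) \<Omega>) xs = map ?i xs"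
        using map_inv_tuple[OF _ ys] a(1) GD(1) by (metis subsetD)
      then show ?thesis using GD(4)[OF a(1)] by metis
    qed
    then show "?i \<in> ?H" using iB by blast
  qed blast
  have GH: "G \<subseteq> ?H" using GD(1) by blast
  have "(\<lambda>g. map g xs) ` ?H = (\<lambda>g. map g xs) ` G" if "xs \<in> tuples m \<Omega>" for xs
    using that GH by blast
  then have orb: "tuple_orbits m \<Omega> ?H = tuple_orbits m \<Omega> G"
    unfolding tuple_orbits_eq by (rule image_cong[OF refl])
  have max: "H \<subseteq> ?H" if H: "subgroup H (BijGroup \<Omega>)"
    and eq: "tuple_orbits m \<Omega> H = tuple_orbits m \<Omega> G" for H
  proof
    fix f assume f: "f \<in> H"
    have "\<exists>g\<in>G. map f xs = map g xs" if xs: "xs \<in> tuples m \<Omega>" for xs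
    proof -
      have "(\<lambda>h. map h xs) ` H \<in> tuple_orbits m \<Omega> G"
        unfolding eq[symmetric] unfolding tuple_orbits_eq using xs by blast
      then obtain ys where ys: "ys \<in> tuples m \<Omega>"
        and e: "(\<lambda>h. map h xs) ` H = (\<lambda>g. map g ys) ` G"
        unfolding tuple_orbits_eq by blast
      have "map (\<lambda>x\<in>\<Omega>. x) xs \<in> (\<lambda>g. map g ys) ` G"
        unfolding e[symmetric] using subgroup_BijD(2)[OF H] by blast
      then obtain a where a: "a \<in> G" "xs = map a ys" using map_id_tuple[OF xs] by auto
      have "map f xs \<in> (\<lambda>g. map g ys) ` G" unfolding e[symmetric] using f by blast
      then obtain b where b: "b \<in> G" "map f xs = map b ys" by blast
      let ?i = "restrict (inv_into \<Omega> a) \<Omega>"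
      have "ys = map ?i xs"
        using map_inv_tuple[OF _ ys] a GD(1) by (metis subsetD)
      then have "map f xs = map (compose \<Omega> b ?i) xs"
        using b(2) map_compose_tuple[OF xs] by metis
      then show ?thesis using GD(3)[OF b(1) GD(4)[OF a(1)]] by blast
    qed
    then show "f \<in> ?H" using f subgroup_BijD(1)[OF H] by blast
  qed
  show eq: "m_closure m \<Omega> G = ?H"
    unfolding m_closure_def by (rule Greatest_equality) (use sub orb max in auto)
  show "subgroup (m_closure m \<Omega> G) (BijGroup \<Omega>)" using sub eq by simp
  show "tuple_orbits m \<Omega> (m_closure m \<Omega> G) = tuple_orbits m \<Omega> G" using orb eq by simp
  show "H \<subseteq> m_closure m \<Omega> G" if "subgroup H (BijGroup \<Omega>)"
    "tuple_orbits m \<Omega> H = tuple_orbits m \<Omega> G" for H using max[OF that] eq by simp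
qed

lemma product_perm_apply:
  assumes "h \<in> Bij \<Delta>" "\<omega> \<in> \<Delta> \<rightarrow>\<^sub>E \<Gamma>" "i \<in> \<Delta>"
  shows "product_perm \<Gamma> \<Delta> g h \<omega> i = g (inv_into \<Delta> h i) (\<omega> (inv_into \<Delta> h i))"
  using assms by (simp add: product_perm_def inv_BijGroup Let_def)

lemma product_perm_in:
  assumes g: "g \<in> \<Delta> \<rightarrow> Bij \<Gamma>" and h: "h \<in> Bij \<Delta>" and w: "\<omega> \<in> \<Delta> \<rightarrow>\<^sub>E \<Gamma>"
  shows "product_perm \<Gamma> \<Delta> g h \<omega> \<in> \<Delta> \<rightarrow>\<^sub>E \<Gamma>"
proof (rule PiE_I)
  fix i assume i: "i \<in> \<Delta>"
  let ?j = "inv_into \<Delta> h i"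
  have j: "?j \<in> \<Delta>" using h i by (rule Bij_inv_into_mem)
  have "g ?j (\<omega> ?j) \<in> \<Gamma>"
    by (rule Bij_apply[OF funcset_mem[OF g j] PiE_mem[OF w j]])
  then show "product_perm \<Gamma> \<Delta> g h \<omega> i \<in> \<Gamma>" using product_perm_apply[OF h w i] by simp
next
  fix i assume "i \<notin> \<Delta>"
  then show "product_perm \<Gamma> \<Delta> g h \<omega> i = undefined" using w by (simp add: product_perm_def)
qed

lemma product_perm_extensional: "product_perm \<Gamma> \<Delta> g h \<in> extensional (\<Delta> \<rightarrow>\<^sub>E \<Gamma>)"
  by (simp add: product_perm_def)

lemma Bij_inv:
  assumes "h \<in> Bij \<Delta>" "i \<in> \<Delta>"
  shows "inv_into \<Delta> h (h i) = i" "h (inv_into \<Delta> h i) = i"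
  using assms by (auto simp: Bij_def bij_betw_def f_inv_into_f)

lemma product_perm_comp:
  assumes g: "g \<in> \<Delta> \<rightarrow> Bij \<Gamma>" "g' \<in> \<Delta> \<rightarrow> Bij \<Gamma>" and h: "h \<in> Bij \<Delta>" "h' \<in> Bij \<Delta>"
  shows "compose (\<Delta> \<rightarrow>\<^sub>E \<Gamma>) (product_perm \<Gamma> \<Delta> g h) (product_perm \<Gamma> \<Delta> g' h') =
    product_perm \<Gamma> \<Delta> (\<lambda>k. compose \<Gamma> (g (h' k)) (g' k)) (compose \<Delta> h h')" (is "?l = ?r")
proof (rule extensionalityI)
  show "?l \<in> extensional (\<Delta> \<rightarrow>\<^sub>E \<Gamma>)" by simp
  show "?r \<in> extensional (\<Delta> \<rightarrow>\<^sub>E \<Gamma>)" by (rule product_perm_extensional)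
  fix \<omega> assume w: "\<omega> \<in> \<Delta> \<rightarrow>\<^sub>E \<Gamma>"
  let ?k = "\<lambda>k. compose \<Gamma> (g (h' k)) (g' k)"
  have k: "?k \<in> \<Delta> \<rightarrow> Bij \<Gamma>"
    using g Bij_apply[OF h(2)] by (simp add: Pi_iff compose_Bij)
  have hh: "compose \<Delta> h h' \<in> Bij \<Delta>" using h by (rule compose_Bij)
  have w': "product_perm \<Gamma> \<Delta> g' h' \<omega> \<in> \<Delta> \<rightarrow>\<^sub>E \<Gamma>"
    using g(2) h(2) w by (rule product_perm_in)
  have "?l \<omega> \<in> \<Delta> \<rightarrow>\<^sub>E \<Gamma>"
    using product_perm_in[OF g(1) h(1) w'] w by (simp add: compose_eq)
  moreover have "?r \<omega> \<in> \<Delta> \<rightarrow>\<^sub>E \<Gamma>" using k hh w by (rule product_perm_in)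
  moreover have "?l \<omega> i = ?r \<omega> i" if i: "i \<in> \<Delta>" for i
  proof -
    define j where "j = inv_into \<Delta> h i"
    define l where "l = inv_into \<Delta> h' j"
    have j: "j \<in> \<Delta>" "h j = i" using h(1) i by (simp_all add: j_def Bij_inv_into_mem Bij_inv)
    have l: "l \<in> \<Delta>" "h' l = j" using h(2) j by (simp_all add: l_def Bij_inv_into_mem Bij_inv)
    have "compose \<Delta> h h' l = i" using j l by (simp add: compose_eq)
    then have inv: "inv_into \<Delta> (compose \<Delta> h h') i = l" using Bij_inv(1)[OF hh l(1)] by simp
    have "?l \<omega> i = g j (product_perm \<Gamma> \<Delta> g' h' \<omega> j)"
      using product_perm_apply[OF h(1) w' i] w by (simp add: compose_eq j_def)
    also have "\<dots> = g j (g' l (\<omega> l))"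
      using product_perm_apply[OF h(2) w j(1)] by (simp add: l_def)
    also have "\<dots> = ?r \<omega> i"
      using product_perm_apply[OF hh w i, of ?k] inv l PiE_mem[OF w l(1)] by (simp add: compose_eq)
    finally show ?thesis .
  qed
  ultimately show "?l \<omega> = ?r \<omega>" by (rule PiE_ext)
qed

lemma product_perm_one:
  assumes "\<And>i. i \<in> \<Delta> \<Longrightarrow> g i = (\<lambda>x\<in>\<Gamma>. x)" 
  shows "product_perm \<Gamma> \<Delta> g (\<lambda>i\<in>\<Delta>. i) = (\<lambda>\<omega> \<in> \<Delta> \<rightarrow>\<^sub>E \<Gamma>. \<omega>)"
proof (rule extensionalityI[OF product_perm_extensional])
  fix \<omega> assume w: "\<omega> \<in> \<Delta> \<rightarrow>\<^sub>E \<Gamma>"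
  have g: "g \<in> \<Delta> \<rightarrow> Bij \<Gamma>" using assms id_Bij by auto
  have inv: "inv_into \<Delta> (\<lambda>i\<in>\<Delta>. i) i = i" if "i \<in> \<Delta>" for i
    using Bij_inv(1)[OF id_Bij that] that by simp
  have "product_perm \<Gamma> \<Delta> g (\<lambda>i\<in>\<Delta>. i) \<omega> = \<omega>"
    by (rule PiE_ext[OF product_perm_in[OF g id_Bij w] w])
      (simp add: product_perm_apply[OF id_Bij w] inv assms PiE_mem[OF w])
  then show "product_perm \<Gamma> \<Delta> g (\<lambda>i\<in>\<Delta>. i) \<omega> = (\<lambda>\<omega> \<in> \<Delta> \<rightarrow>\<^sub>E \<Gamma>. \<omega>) \<omega>"
    using w by (simp only: restrict_apply')
qed (rule restrict_extensional)

lemma compose_Bij_inv: "f \<in> Bij S \<Longrightarrow> compose S f (restrict (inv_into S f) S) = (\<lambda>x\<in>S. x)"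
  by (rule ext) (auto simp: compose_def Bij_inv Bij_inv_into_mem)

lemma product_action_subgroup:
  assumes K: "subgroup K (BijGroup \<Gamma>)" and L: "subgroup L (BijGroup \<Delta>)"
  shows "subgroup (product_action \<Gamma> \<Delta> K L) (BijGroup (\<Delta> \<rightarrow>\<^sub>E \<Gamma>))"
proof -
  note KD = subgroup_BijD[OF K] and LD = subgroup_BijD[OF L]
  let ?P = "\<Delta> \<rightarrow>\<^sub>E \<Gamma>" and ?G = "product_action \<Gamma> \<Delta> K L"
  have mem: "product_perm \<Gamma> \<Delta> g h \<in> ?G" if "g \<in> \<Delta> \<rightarrow> K" "h \<in> L" for g h
    using that by (auto simp: product_action_def)
  have one: "(\<lambda>\<omega>\<in>?P. \<omega>) \<in> ?G"
    using mem[of "\<lambda>_. \<lambda>x\<in>\<Gamma>. x" "\<lambda>i\<in>\<Delta>. i"] KD(2) LD(2) by (simp add: product_perm_one)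
  have comp: "compose ?P f f' \<in> ?G" if f: "f \<in> ?G" and f': "f' \<in> ?G" for f f'
  proof -
    obtain g h where 1: "f = product_perm \<Gamma> \<Delta> g h" "g \<in> \<Delta> \<rightarrow> K" "h \<in> L"
      using f by (auto simp: product_action_def)
    obtain g' h' where 2: "f' = product_perm \<Gamma> \<Delta> g' h'" "g' \<in> \<Delta> \<rightarrow> K" "h' \<in> L"
      using f' by (auto simp: product_action_def)
    have h: "h \<in> Bij \<Delta>" "h' \<in> Bij \<Delta>" using 1 2 LD(1) by auto
    have g: "g \<in> \<Delta> \<rightarrow> Bij \<Gamma>" "g' \<in> \<Delta> \<rightarrow> Bij \<Gamma>" using 1 2 KD(1) by auto
    have "(\<lambda>k. compose \<Gamma> (g (h' k)) (g' k)) \<in> \<Delta> \<rightarrow> K"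
      using 1(2) 2(2) Bij_apply[OF h(2)] by (simp add: Pi_iff KD(3))
    then show ?thesis
      unfolding 1 2 product_perm_comp[OF g h] using 1 2 LD(3) by (intro mem)
  qed
  have inv: "\<exists>f'\<in>?G. (\<forall>\<omega>\<in>?P. f \<omega> \<in> ?P \<and> f' \<omega> \<in> ?P \<and> f (f' \<omega>) = \<omega> \<and> f' (f \<omega>) = \<omega>)
      \<and> f \<in> extensional ?P \<and> f' \<in> extensional ?P"
    if f: "f \<in> ?G" for f
  proof -
    obtain g h where 1: "f = product_perm \<Gamma> \<Delta> g h" "g \<in> \<Delta> \<rightarrow> K" "h \<in> L"
      using f by (auto simp: product_action_def)
    define h' where "h' = restrict (inv_into \<Delta> h) \<Delta>"
    define g' where "g' = (\<lambda>j. restrict (inv_into \<Gamma> (g (h' j))) \<Gamma>)"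
    have h: "h \<in> Bij \<Delta>" using 1 LD(1) by auto
    have h'L: "h' \<in> L" using 1 LD(4) by (simp add: h'_def)
    then have h': "h' \<in> Bij \<Delta>" using LD(1) by auto
    have g: "g \<in> \<Delta> \<rightarrow> Bij \<Gamma>" using 1 KD(1) by auto
    have g'K: "g' \<in> \<Delta> \<rightarrow> K"
      using 1(2) Bij_apply[OF h'] KD(4) unfolding g'_def by blast
    then have g': "g' \<in> \<Delta> \<rightarrow> Bij \<Gamma>" using KD(1) by auto
    let ?f' = "product_perm \<Gamma> \<Delta> g' h'"
    have hh: "compose \<Delta> h h' = (\<lambda>i\<in>\<Delta>. i)" "compose \<Delta> h' h = (\<lambda>i\<in>\<Delta>. i)"
      using h by (simp_all add: h'_def compose_Bij_inv Bij_compose_restrict_eq)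
    have c1: "compose ?P f ?f' = (\<lambda>\<omega>\<in>?P. \<omega>)"
      unfolding 1 product_perm_comp[OF g g' h h'] hh
    proof (rule product_perm_one)
      fix i assume "i \<in> \<Delta>"
      then have "g (h' i) \<in> Bij \<Gamma>" using g Bij_apply[OF h'] by blast
      then show "compose \<Gamma> (g (h' i)) (g' i) = (\<lambda>x\<in>\<Gamma>. x)"
        unfolding g'_def by (rule compose_Bij_inv)
    qed
    have c2: "compose ?P ?f' f = (\<lambda>\<omega>\<in>?P. \<omega>)"
      unfolding 1 product_perm_comp[OF g' g h' h] hh
    proof (rule product_perm_one)
      fix i assume i: "i \<in> \<Delta>"
      then have gi: "g i \<in> Bij \<Gamma>" using g by auto
      have "h' (h i) = i" using h i by (simp add: h'_def Bij_apply Bij_inv)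
      then show "compose \<Gamma> (g' (h i)) (g i) = (\<lambda>x\<in>\<Gamma>. x)"
        unfolding g'_def using Bij_compose_restrict_eq[OF gi] by simp
    qed
    have "f (?f' \<omega>) = \<omega>" "?f' (f \<omega>) = \<omega>" if "\<omega> \<in> ?P" for \<omega>
      using fun_cong[OF c1, of \<omega>] fun_cong[OF c2, of \<omega>] that by (simp_all add: compose_eq)
    moreover have "f \<omega> \<in> ?P" "?f' \<omega> \<in> ?P" if "\<omega> \<in> ?P" for \<omega>
      using product_perm_in[OF g h that] product_perm_in[OF g' h' that] 1 by simp_all
    ultimately show ?thesis
      using mem[OF g'K h'L] product_perm_extensional[of \<Gamma> \<Delta>] 1(1)
      by (intro bexI[of _ ?f'] conjI ballI) simp_all
  qed
  have inv': "f \<in> Bij ?P \<and> restrict (inv_into ?P f) ?P \<in> ?G" if f: "f \<in> ?G" for f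
  proof -
    obtain f' where f': "f' \<in> ?G" "f' \<in> extensional ?P" and e: "f \<in> extensional ?P"
      and m: "\<And>\<omega>. \<omega> \<in> ?P \<Longrightarrow> f \<omega> \<in> ?P" "\<And>\<omega>. \<omega> \<in> ?P \<Longrightarrow> f' \<omega> \<in> ?P"
      and c: "\<And>\<omega>. \<omega> \<in> ?P \<Longrightarrow> f (f' \<omega>) = \<omega>" "\<And>\<omega>. \<omega> \<in> ?P \<Longrightarrow> f' (f \<omega>) = \<omega>"
      using inv[OF f] by metis
    have b: "bij_betw f ?P ?P"
      by (rule bij_betw_byWitness[where f' = f']) (use m c in blast)+
    then have fB: "f \<in> Bij ?P" using e by (simp add: Bij_def)
    have "restrict (inv_into ?P f) ?P = f'"
    proof (rule extensionalityI[OF _ f'(2)])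
      fix \<omega> assume w: "\<omega> \<in> ?P"
      then have "inv_into ?P f \<omega> = f' \<omega>"
        using Bij_inv(1)[OF fB m(2)[OF w]] c(1)[OF w] by metis
      then show "restrict (inv_into ?P f) ?P \<omega> = f' \<omega>" using w by (simp only: restrict_apply')
    qed simp
    then show ?thesis using fB f' by simp
  qed
  show ?thesis
    by (rule subgroup_BijI) (use one comp inv' in blast)+
qed

end

theory Submission
  imports Defs
begin

text \<open>
  Let \<open>f\<close> belong to the \<open>m\<close>-closure of \<open>K \<up> L\<close>, and suppose that \<open>\<Gamma>\<close> has at least two points.
  Every element of \<open>K \<up> L\<close> preserves the Hamming distance on \<open>\<Gamma>\<^sup>d\<close>, a relation between two words,
  so \<open>m \<ge> 2\<close> forces \<open>f\<close> to preserve it as well. An isometry of the Hamming space lies in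
  \<open>Sym(\<Gamma>) \<up> Sym(\<Delta>)\<close> (\<open>hamming_isometry_product_perm\<close>), that is, \<open>f = (g\<^sub>1,\<dots>,g\<^sub>d; h)\<close>. It remains
  to place each \<open>g\<^sub>i\<close> in \<open>K\<^sup>(\<^sup>m\<^sup>)\<close> and \<open>h\<close> in \<open>L\<^sup>(\<^sup>m\<^sup>)\<close>.

  Write \<open>m\<close> words as the rows of an array with one column, an element of \<open>\<Gamma>\<^sup>m\<close>, for each
  coordinate. On these words \<open>f\<close> agrees with some element of \<open>K \<up> L\<close> with top component
  \<open>h' \<in> L\<close>; compared column by column (\<open>closure_columns\<close>), this says that \<open>g\<^sub>i\<close> carries column \<open>i\<close>
  to a \<open>K\<close>-image of column \<open>j\<close>, where \<open>h i = h' j\<close>. If all columns are equal, this is the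
  statement that \<open>g\<^sub>i\<close> belongs to \<open>K\<^sup>(\<^sup>m\<^sup>)\<close>. Since \<open>g\<^sub>i\<close> then respects the \<open>K\<close>-orbits on \<open>\<Gamma>\<^sup>m\<close>, the
  columns \<open>i\<close> and \<open>j\<close> always lie in the same \<open>K\<close>-orbit.

  So to show that \<open>h\<close> agrees on given coordinates \<open>i\<^sub>1,\<dots>,i\<^sub>m\<close> with an element of \<open>L\<close>, it is enough
  to give these coordinates columns from distinct \<open>K\<close>-orbits, and all other coordinates a column
  from yet another orbit: then \<open>h i\<^sub>t = h' i\<^sub>t\<close>. This needs \<open>m + 1\<close> orbits of \<open>K\<close> on \<open>\<Gamma>\<^sup>m\<close>. For
  \<open>m \<ge> 3\<close> they exist for every \<open>K\<close>, as tuples with different patterns of equal entries are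
  inequivalent. For \<open>m = 2\<close> there are at least three orbits on pairs exactly when \<open>K\<close> is not 2-transitive
  (\<open>ex_inequivalent_tuples\<close>), which is where the exception in the theorem comes from.

  If \<open>\<Gamma>\<close> is a single point, there is only one word, and \<open>f\<close> is the identity.
\<close>

section \<open>Isometries of the Hamming space\<close>

definition disagreement :: "'b set \<Rightarrow> ('b \<Rightarrow> 'a) \<Rightarrow> ('b \<Rightarrow> 'a) \<Rightarrow> 'b set" where
  "disagreement \<Delta> u v = {i \<in> \<Delta>. u i \<noteq> v i}"

lemma finite_disagreement [simp]: "finite \<Delta> \<Longrightarrow> finite (disagreement \<Delta> u v)"
  by (simp add: disagreement_def)

text \<open>
  The value of a word at a coordinate can be read off from distances alone. This is how an
  isometry is recovered from the images of one word and its neighbours.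
\<close>

lemma update_closer_iff:
  assumes "finite \<Delta>" "i \<in> \<Delta>" "x \<noteq> v i"
  shows "card (disagreement \<Delta> w (v(i := x))) < card (disagreement \<Delta> w v) \<longleftrightarrow> w i = x"
proof
  assume "w i = x"
  then have "disagreement \<Delta> w (v(i := x)) \<subset> disagreement \<Delta> w v"
    using assms by (auto simp: disagreement_def)
  then show "card (disagreement \<Delta> w (v(i := x))) < card (disagreement \<Delta> w v)"
    using assms(1) by (simp add: psubset_card_mono)
next
  assume less: "card (disagreement \<Delta> w (v(i := x))) < card (disagreement \<Delta> w v)"
  show "w i = x"
  proof (rule ccontr)
    assume "w i \<noteq> x"
    then have "disagreement \<Delta> w v \<subseteq> disagreement \<Delta> w (v(i := x))"
      by (auto simp: disagreement_def)
    then show False using less card_mono assms(1) finite_disagreement by (metis leD)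
  qed
qed

lemma product_perm_at_image:
  assumes "h \<in> Bij \<Delta>" "\<omega> \<in> \<Delta> \<rightarrow>\<^sub>E \<Gamma>" "i \<in> \<Delta>"
  shows "product_perm \<Gamma> \<Delta> g h \<omega> (h i) = g i (\<omega> i)"
  using assms by (simp add: product_perm_apply Bij_apply Bij_inv)

lemma product_perm_isometry:
  assumes g: "g \<in> \<Delta> \<rightarrow> Bij \<Gamma>" and h: "h \<in> Bij \<Delta>"
    and u: "u \<in> \<Delta> \<rightarrow>\<^sub>E \<Gamma>" and v: "v \<in> \<Delta> \<rightarrow>\<^sub>E \<Gamma>"
  shows "card (disagreement \<Delta> (product_perm \<Gamma> \<Delta> g h u) (product_perm \<Gamma> \<Delta> g h v)) =
    card (disagreement \<Delta> u v)"
proof -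
  have neq: "product_perm \<Gamma> \<Delta> g h u (h i) \<noteq> product_perm \<Gamma> \<Delta> g h v (h i) \<longleftrightarrow> u i \<noteq> v i"
    if i: "i \<in> \<Delta>" for i
  proof -
    have "inj_on (g i) \<Gamma>" using g i by (auto simp: Bij_def bij_betw_def)
    then show ?thesis
      using PiE_mem[OF u i] PiE_mem[OF v i] i h u v
      by (simp add: product_perm_at_image inj_on_eq_iff)
  qed
  have inj: "inj_on h \<Delta>" and im: "h ` \<Delta> = \<Delta>" using h by (auto simp: Bij_def bij_betw_def)
  have "disagreement \<Delta> (product_perm \<Gamma> \<Delta> g h u) (product_perm \<Gamma> \<Delta> g h v) =
      h ` disagreement \<Delta> u v"
  proof (rule Set.set_eqI)
    fix j
    show "j \<in> disagreement \<Delta> (product_perm \<Gamma> \<Delta> g h u) (product_perm \<Gamma> \<Delta> g h v) \<longleftrightarrow>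
        j \<in> h ` disagreement \<Delta> u v"
    proof
      assume j: "j \<in> disagreement \<Delta> (product_perm \<Gamma> \<Delta> g h u) (product_perm \<Gamma> \<Delta> g h v)"
      then have "j \<in> h ` \<Delta>" unfolding im by (simp add: disagreement_def)
      then obtain i where i: "i \<in> \<Delta>" "j = h i" by blast
      then have "i \<in> disagreement \<Delta> u v" using j neq[OF i(1)] by (simp add: disagreement_def)
      then show "j \<in> h ` disagreement \<Delta> u v" using i(2) by blast
    next
      assume "j \<in> h ` disagreement \<Delta> u v"
      then obtain i where i: "i \<in> \<Delta>" "j = h i" "u i \<noteq> v i" by (auto simp: disagreement_def)
      then show "j \<in> disagreement \<Delta> (product_perm \<Gamma> \<Delta> g h u) (product_perm \<Gamma> \<Delta> g h v)"
        using neq[OF i(1)] Bij_apply[OF h] by (simp add: disagreement_def)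
    qed
  qed
  moreover have "inj_on h (disagreement \<Delta> u v)"
    by (rule inj_on_subset[OF inj]) (auto simp: disagreement_def)
  ultimately show ?thesis by (simp add: card_image)
qed

text \<open>
  Fix a constant word \<open>z\<close>. Two neighbours of \<open>z\<close> that differ from it in the same coordinate are at
  distance at most 1, and otherwise at distance 2. So an isometry \<open>f\<close> maps the neighbours of \<open>z\<close>
  in direction \<open>i\<close> to neighbours of \<open>f z\<close> in a direction \<open>h i\<close>, which defines \<open>h\<close>, and the
  letter in that direction defines \<open>g i\<close>. Any other word is determined by its distances to \<open>z\<close> and
  its neighbours, so \<open>f\<close> acts on it by the same \<open>g\<close> and \<open>h\<close>.
\<close>

lemma hamming_isometry_coordinates:
  fixes \<Gamma> :: "'a set" and \<Delta> :: "'b set"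
  assumes fin: "finite \<Gamma>" "finite \<Delta>"
    and ab: "a \<in> \<Gamma>" "b \<in> \<Gamma>" "a \<noteq> b"
    and f: "\<And>u. u \<in> \<Delta> \<rightarrow>\<^sub>E \<Gamma> \<Longrightarrow> f u \<in> \<Delta> \<rightarrow>\<^sub>E \<Gamma>"
    and iso: "\<And>u v. u \<in> \<Delta> \<rightarrow>\<^sub>E \<Gamma> \<Longrightarrow> v \<in> \<Delta> \<rightarrow>\<^sub>E \<Gamma> \<Longrightarrow>
      card (disagreement \<Delta> (f u) (f v)) = card (disagreement \<Delta> u v)"
  obtains g h where "g \<in> \<Delta> \<rightarrow> Bij \<Gamma>" "h \<in> Bij \<Delta>"
    "\<And>u i. u \<in> \<Delta> \<rightarrow>\<^sub>E \<Gamma> \<Longrightarrow> i \<in> \<Delta> \<Longrightarrow> f u (h i) = g i (u i)"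
proof -
  let ?P = "\<Delta> \<rightarrow>\<^sub>E \<Gamma>" and ?D = "disagreement \<Delta>"
  define z where "z = (\<lambda>i\<in>\<Delta>. a)"
  have z: "z \<in> ?P" "\<And>i. i \<in> \<Delta> \<Longrightarrow> z i = a" using ab by (auto simp: z_def)
  have zu: "z(i := x) \<in> ?P" if "i \<in> \<Delta>" "x \<in> \<Gamma>" for i x
    using that ab by (auto simp: z_def PiE_iff extensional_def)
  have ex1: "\<exists>p\<in>\<Delta>. ?D (f z) (f (z(i := x))) = {p}" if i: "i \<in> \<Delta>" "x \<in> \<Gamma>" "x \<noteq> a" for i x
  proof -
    have "?D z (z(i := x)) = {i}" using i z(2) by (auto simp: disagreement_def)
    then have "card (?D (f z) (f (z(i := x)))) = 1" using iso[OF z(1) zu[OF i(1,2)]] by simp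
    then obtain p where "?D (f z) (f (z(i := x))) = {p}" by (rule card_1_singletonE)
    moreover from this have "p \<in> \<Delta>" by (auto simp: disagreement_def)
    ultimately show ?thesis by blast
  qed
  then have "\<forall>i\<in>\<Delta>. \<exists>p\<in>\<Delta>. ?D (f z) (f (z(i := b))) = {p}" using ab by metis
  then obtain h0 where h0: "\<And>i. i \<in> \<Delta> \<Longrightarrow> h0 i \<in> \<Delta>"
    "\<And>i. i \<in> \<Delta> \<Longrightarrow> ?D (f z) (f (z(i := b))) = {h0 i}" by metis
  have dir: "?D (f z) (f (z(i := x))) = {h0 i}" if i: "i \<in> \<Delta>" "x \<in> \<Gamma>" "x \<noteq> a" for i x
  proof (rule ccontr)
    assume ne: "?D (f z) (f (z(i := x))) \<noteq> {h0 i}"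
    obtain p where p: "p \<in> \<Delta>" "?D (f z) (f (z(i := x))) = {p}" using ex1[OF i] by blast
    have ph: "p \<noteq> h0 i" using ne p by auto
    have xb: "x \<noteq> b" using ne h0(2)[OF i(1)] by auto
    have differ: "q \<in> \<Delta> \<and> f z q \<noteq> f (z(i := x)) q \<longleftrightarrow> q = p"
      "q \<in> \<Delta> \<and> f z q \<noteq> f (z(i := b)) q \<longleftrightarrow> q = h0 i" for q
      using p(2) h0(2)[OF i(1)] unfolding disagreement_def set_eq_iff by simp_all
    have "{p, h0 i} \<subseteq> ?D (f (z(i := x))) (f (z(i := b)))"
    proof -
      have "p \<in> \<Delta>" "f z p \<noteq> f (z(i := x)) p" "f z p = f (z(i := b)) p"
        using differ[of p] ph by blast+
      moreover have "h0 i \<in> \<Delta>" "f z (h0 i) \<noteq> f (z(i := b)) (h0 i)"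
        "f z (h0 i) = f (z(i := x)) (h0 i)"
        using differ[of "h0 i"] ph by blast+
      ultimately show ?thesis unfolding disagreement_def by simp
    qed
    then have "card {p, h0 i} \<le> card (?D (f (z(i := x))) (f (z(i := b))))"
      using fin(2) by (intro card_mono) simp_all
    then have "2 \<le> card (?D (f (z(i := x))) (f (z(i := b))))" using ph by simp
    also have "\<dots> = card (?D (z(i := x)) (z(i := b)))"
      using i ab by (intro iso zu)
    also have "?D (z(i := x)) (z(i := b)) = {i}"
      using i(1) xb by (auto simp: disagreement_def)
    finally show False by simp
  qed
  have out: "f (z(i := x)) j = f z j" if "i \<in> \<Delta>" "x \<in> \<Gamma>" "j \<noteq> h0 i" for i x j
  proof (cases "x = a")
    case True
    then have "z(i := x) = z" using z(2)[OF that(1)] by (metis fun_upd_triv)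
    then show ?thesis by simp
  next
    case False
    show ?thesis
    proof (cases "j \<in> \<Delta>")
      case True
      have "j \<notin> ?D (f z) (f (z(i := x)))" unfolding dir[OF that(1,2) False] using that(3) by simp
      then show ?thesis using True by (simp add: disagreement_def)
    next
      case jn: False
      then show ?thesis
        using PiE_arb[OF f[OF zu[OF that(1,2)]] jn] PiE_arb[OF f[OF z(1)] jn] by simp
    qed
  qed
  have injh: "inj_on h0 \<Delta>"
  proof (rule inj_onI, rule ccontr)
    fix i j assume ij: "i \<in> \<Delta>" "j \<in> \<Delta>" "h0 i = h0 j" "i \<noteq> j"
    have "?D (z(i := b)) (z(j := b)) = {i, j}"
      using ij z(2) ab by (auto simp: disagreement_def)
    then have "card (?D (f (z(i := b))) (f (z(j := b)))) = 2"
      using iso[OF zu zu] ij ab by simp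
    moreover have "?D (f (z(i := b))) (f (z(j := b))) \<subseteq> {h0 i}"
    proof
      fix k assume "k \<in> ?D (f (z(i := b))) (f (z(j := b)))"
      then have "f (z(i := b)) k \<noteq> f (z(j := b)) k" by (simp add: disagreement_def)
      then have "k = h0 i" using out[OF ij(1) ab(2)] out[OF ij(2) ab(2)] ij(3) by metis
      then show "k \<in> {h0 i}" by simp
    qed
    ultimately have "2 \<le> card {h0 i}"
      using card_mono[of "{h0 i}" "?D (f (z(i := b))) (f (z(j := b)))"] by simp
    then show False by simp
  qed
  define h where "h = restrict h0 \<Delta>"
  have "h0 ` \<Delta> = \<Delta>" by (rule endo_inj_surj[OF fin(2) _ injh]) (use h0(1) in blast)
  then have hB: "h \<in> Bij \<Delta>" using injh by (auto simp: h_def Bij_def bij_betw_def)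
  define g where "g = (\<lambda>i. \<lambda>x\<in>\<Gamma>. f (z(i := x)) (h0 i))"
  have gm: "g i x \<in> \<Gamma>" if "i \<in> \<Delta>" "x \<in> \<Gamma>" for i x
    using PiE_mem[OF f[OF zu[OF that]] h0(1)[OF that(1)]] that by (simp add: g_def)
  have injg: "inj_on (g i) \<Gamma>" if i: "i \<in> \<Delta>" for i
  proof (rule inj_onI)
    fix x y assume xy: "x \<in> \<Gamma>" "y \<in> \<Gamma>" "g i x = g i y"
    have eq: "f (z(i := x)) k = f (z(i := y)) k" for k
    proof (cases "k = h0 i")
      case True
      then show ?thesis using xy by (simp add: g_def)
    next
      case False
      then show ?thesis using out[OF i xy(1)] out[OF i xy(2)] by simp
    qed
    have "?D (f (z(i := x))) (f (z(i := y))) = {}"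
      unfolding disagreement_def using eq by simp
    then have "card (?D (z(i := x)) (z(i := y))) = 0"
      using iso[OF zu[OF i xy(1)] zu[OF i xy(2)]] by (metis card.empty)
    then have "?D (z(i := x)) (z(i := y)) = {}" using fin(2) by simp
    then show "x = y" using i by (auto simp: disagreement_def)
  qed
  have surjg: "g i ` \<Gamma> = \<Gamma>" if i: "i \<in> \<Delta>" for i
    by (rule endo_inj_surj[OF fin(1) _ injg[OF i]]) (use gm[OF i] in blast)
  have gB: "g \<in> \<Delta> \<rightarrow> Bij \<Gamma>"
    using injg surjg by (auto simp: Bij_def bij_betw_def g_def)
  have read: "f u (h0 i) = g i x \<longleftrightarrow> u i = x"
    if u: "u \<in> ?P" and i: "i \<in> \<Delta>" and x: "x \<in> \<Gamma>" "x \<noteq> a" for u i x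
  proof -
    have upd: "f (z(i := x)) = (f z)(h0 i := g i x)"
      using out[OF i x(1)] x(1) by (auto simp: g_def)
    have "h0 i \<in> ?D (f z) (f (z(i := x)))" using dir[OF i x] by simp
    then have ne: "g i x \<noteq> f z (h0 i)" using x(1) by (auto simp: disagreement_def g_def)
    have "f u (h0 i) = g i x \<longleftrightarrow>
        card (?D (f u) (f (z(i := x)))) < card (?D (f u) (f z))"
      unfolding upd by (rule update_closer_iff[OF fin(2) h0(1)[OF i], symmetric]) (rule ne)
    also have "\<dots> \<longleftrightarrow> card (?D u (z(i := x))) < card (?D u z)"
      using iso[OF u zu[OF i x(1)]] iso[OF u z(1)] by simp
    also have "\<dots> \<longleftrightarrow> u i = x"
      using update_closer_iff[OF fin(2) i, of x z u] z(2)[OF i] x(2) by simp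
    finally show ?thesis .
  qed
  have main: "f u (h i) = g i (u i)" if u: "u \<in> ?P" and i: "i \<in> \<Delta>" for u i
  proof -
    have "f u (h0 i) \<in> g i ` \<Gamma>" using PiE_mem[OF f[OF u] h0(1)[OF i]] surjg[OF i] by simp
    then obtain x where x: "x \<in> \<Gamma>" "f u (h0 i) = g i x" by blast
    have ui: "u i \<in> \<Gamma>" using u i by (rule PiE_mem)
    have "u i = x"
    proof (cases "x = a")
      case False
      then show ?thesis using read[OF u i x(1)] x(2) by simp
    next
      case True
      show ?thesis
      proof (rule ccontr)
        assume ne: "u i \<noteq> x"
        then have "f u (h0 i) = g i (u i)" using read[OF u i ui] True by simp
        then show False using x injg[OF i] ui ne by (simp add: inj_on_eq_iff)
      qed
    qed
    then show ?thesis using x i by (simp add: h_def)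
  qed
  show thesis using that[OF gB hB main] .
qed

lemma hamming_isometry_product_perm:
  assumes "finite \<Gamma>" "finite \<Delta>" "a \<in> \<Gamma>" "b \<in> \<Gamma>" "a \<noteq> b"
    and f: "f \<in> Bij (\<Delta> \<rightarrow>\<^sub>E \<Gamma>)"
    and iso: "\<And>u v. u \<in> \<Delta> \<rightarrow>\<^sub>E \<Gamma> \<Longrightarrow> v \<in> \<Delta> \<rightarrow>\<^sub>E \<Gamma> \<Longrightarrow>
      card (disagreement \<Delta> (f u) (f v)) = card (disagreement \<Delta> u v)"
  obtains g h where "g \<in> \<Delta> \<rightarrow> Bij \<Gamma>" "h \<in> Bij \<Delta>" "f = product_perm \<Gamma> \<Delta> g h"
proof -
  obtain g h where g: "g \<in> \<Delta> \<rightarrow> Bij \<Gamma>" and h: "h \<in> Bij \<Delta>"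
    and fgh: "\<And>u i. u \<in> \<Delta> \<rightarrow>\<^sub>E \<Gamma> \<Longrightarrow> i \<in> \<Delta> \<Longrightarrow> f u (h i) = g i (u i)"
    using hamming_isometry_coordinates[OF assms(1-5) Bij_apply[OF f] iso] by metis
  have "f = product_perm \<Gamma> \<Delta> g h"
  proof (rule extensionalityI[OF _ product_perm_extensional])
    show "f \<in> extensional (\<Delta> \<rightarrow>\<^sub>E \<Gamma>)" using f by (simp add: Bij_def)
    fix u assume u: "u \<in> \<Delta> \<rightarrow>\<^sub>E \<Gamma>"
    show "f u = product_perm \<Gamma> \<Delta> g h u"
    proof (rule PiE_ext[OF Bij_apply[OF f u] product_perm_in[OF g h u]])
      fix i assume i: "i \<in> \<Delta>"
      have "inv_into \<Delta> h i \<in> \<Delta>" "h (inv_into \<Delta> h i) = i"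
        using h i by (simp_all add: Bij_inv_into_mem Bij_inv)
      then show "f u i = product_perm \<Gamma> \<Delta> g h u i"
        using fgh[OF u] product_perm_at_image[OF h u] by metis
    qed
  qed
  then show thesis using that g h by blast
qed

section \<open>Separating coordinates by orbits on tuples\<close>

text \<open>
  For \<open>m \<ge> 3\<close>, take the tuples with a single entry \<open>y\<close> and all other entries \<open>x\<close>, together with
  the constant tuple: two of them differ in whether some two entries are equal, so no permutation
  at all relates them. For \<open>m = 2\<close> this leaves only an equal and an unequal pair, and a third orbit
  is a second orbit on unequal pairs.
\<close>

lemma ex_inequivalent_tuples:
  assumes K: "subgroup K (BijGroup \<Gamma>)" and xy: "x \<in> \<Gamma>" "y \<in> \<Gamma>" "x \<noteq> y"
    and m: "m \<ge> 2" and nt: "\<not> (m = 2 \<and> two_transitive \<Gamma> K)"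
  obtains c where "\<And>s. s \<le> m \<Longrightarrow> c s \<in> tuples m \<Gamma>"
    "\<And>s t k k'. s \<le> m \<Longrightarrow> t \<le> m \<Longrightarrow> k \<in> K \<Longrightarrow> k' \<in> K \<Longrightarrow>
      map k (c s) = map k' (c t) \<Longrightarrow> s = t"
proof (cases "m = 2")
  case True
  note KD = subgroup_BijD[OF K]
  have "\<not> two_transitive \<Gamma> K" using nt True by simp
  then obtain a b a' b' where ab: "a \<in> \<Gamma>" "b \<in> \<Gamma>" "a' \<in> \<Gamma>" "b' \<in> \<Gamma>" "a \<noteq> b" "a' \<noteq> b'"
    and no: "\<not> (\<exists>k\<in>K. k a = a' \<and> k b = b')"
    using xy unfolding two_transitive_def by blast
  have inj: "inj_on k \<Gamma>" if "k \<in> K" for k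
    using KD(1) that by (auto simp: Bij_def bij_betw_def)
  have no': "\<not> (k a = k' a' \<and> k b = k' b')" if k: "k \<in> K" "k' \<in> K" for k k'
  proof
    assume e: "k a = k' a' \<and> k b = k' b'"
    let ?i = "compose \<Gamma> (restrict (inv_into \<Gamma> k') \<Gamma>) k"
    have k'B: "k' \<in> Bij \<Gamma>" using KD(1) k by blast
    have "?i \<in> K" using KD(3)[OF KD(4)[OF k(2)] k(1)] .
    moreover have "?i a = a'" "?i b = b'"
      using e ab k'B by (simp_all add: compose_eq Bij_apply Bij_inv)
    ultimately show False using no by blast
  qed
  define c where "c = (\<lambda>s::nat. if s = 0 then [a, a] else if s = 1 then [a, b] else [a', b'])"
  show thesis
  proof (rule that[of c])
    show "c s \<in> tuples m \<Gamma>" for s using True ab by (simp add: c_def tuples_def)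
    fix s t k k'
    assume st: "s \<le> m" "t \<le> m" and k: "k \<in> K" "k' \<in> K" and e: "map k (c s) = map k' (c t)"
    have "k a \<noteq> k b" "k a' \<noteq> k b'" "k' a \<noteq> k' b" "k' a' \<noteq> k' b'"
      using inj[OF k(1)] inj[OF k(2)] ab by (simp_all add: inj_on_eq_iff)
    moreover have "\<not> (k a = k' a' \<and> k b = k' b')" "\<not> (k' a = k a' \<and> k' b = k b')"
      using no'[OF k] no'[OF k(2,1)] by simp_all
    moreover have "s \<in> {0, 1, 2}" "t \<in> {0, 1, 2}" using st True by auto
    ultimately show "s = t" using e by (auto simp: c_def split: if_splits)
  qed
next
  case False
  \<comment> \<open>For \<open>s = m\<close> the update is out of range and leaves the constant tuple.\<close>
  define c where "c = (\<lambda>s. (replicate m x)[s := y])"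
  have c_nth: "c s ! r = (if r = s then y else x)" if "r < m" for r s
    using that by (simp add: c_def nth_list_update)
  have len: "length (c s) = m" for s by (simp add: c_def)
  have c: "c s \<in> tuples m \<Gamma>" for s
    using xy set_update_subset_insert[of "replicate m x" s y] by (auto simp: tuples_def c_def)
  have sep: False if st: "s < m" "t \<le> m" "s \<noteq> t" and k: "k \<in> K" "k' \<in> K"
    and e: "map k (c s) = map k' (c t)" for s t k k'
  proof -
    have "card ({..<m} - {s, t}) > 0"
      using st False m diff_card_le_card_Diff[of "{s, t}" "{..<m}"] by simp
    then obtain r where r: "r < m" "r \<noteq> s" "r \<noteq> t" by (auto simp: card_gt_0_iff)
    have "k y = k' x" using arg_cong[OF e, of "\<lambda>l. l ! s"] st by (simp add: len c_nth)
    moreover have "k x = k' x" using arg_cong[OF e, of "\<lambda>l. l ! r"] r by (simp add: len c_nth)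
    moreover have "inj_on k \<Gamma>"
      using subgroup_BijD(1)[OF K] k(1) by (auto simp: Bij_def bij_betw_def)
    ultimately have "y = x" using xy inj_onD[of k \<Gamma> y x] by simp
    then show False using xy(3) by simp
  qed
  show thesis
  proof (rule that[OF c])
    fix s t k k'
    assume st: "s \<le> m" "t \<le> m" and k: "k \<in> K" "k' \<in> K" and e: "map k (c s) = map k' (c t)"
    show "s = t"
    proof (rule ccontr)
      assume "s \<noteq> t"
      then consider "s < m" | "t < m" using st by linarith
      then show False using sep st k e \<open>s \<noteq> t\<close> by cases metis+
    qed
  qed
qed

text \<open>
  Agreement of \<open>f\<close> with one element of \<open>K \<up> L\<close> on \<open>m\<close> words, the rows of an array, is turned into
  a condition on the columns. The columns can be chosen freely, and \<open>h'\<close> serves all of them at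
  once, although it depends on the choice.
\<close>

lemma closure_columns:
  assumes L: "subgroup L (BijGroup \<Delta>)" and K: "subgroup K (BijGroup \<Gamma>)"
    and h: "h \<in> Bij \<Delta>"
    and f: "product_perm \<Gamma> \<Delta> g h \<in> m_closure m (\<Delta> \<rightarrow>\<^sub>E \<Gamma>) (product_action \<Gamma> \<Delta> K L)"
    and col: "\<And>i. i \<in> \<Delta> \<Longrightarrow> col i \<in> tuples m \<Gamma>"
  obtains h' where "h' \<in> L"
    "\<And>i j. i \<in> \<Delta> \<Longrightarrow> j \<in> \<Delta> \<Longrightarrow> h i = h' j \<Longrightarrow> \<exists>k\<in>K. map (g i) (col i) = map k (col j)"
proof -
  define row where "row = (\<lambda>t. \<lambda>i\<in>\<Delta>. col i ! t)"
  have row: "row t \<in> \<Delta> \<rightarrow>\<^sub>E \<Gamma>" if "t < m" for t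
    using col that by (fastforce simp: row_def tuples_def)
  have "map row [0..<m] \<in> tuples m (\<Delta> \<rightarrow>\<^sub>E \<Gamma>)" using row by (simp add: tuples_def image_subset_iff)
  then obtain f' where f': "f' \<in> product_action \<Gamma> \<Delta> K L"
    and e: "map (product_perm \<Gamma> \<Delta> g h) (map row [0..<m]) = map f' (map row [0..<m])"
    using f m_closure_eq(1)[OF product_action_subgroup[OF K L]] by blast
  obtain g' h' where gh': "f' = product_perm \<Gamma> \<Delta> g' h'" "g' \<in> \<Delta> \<rightarrow> K" "h' \<in> L"
    using f' by (auto simp: product_action_def)
  have h': "h' \<in> Bij \<Delta>" using gh' subgroup_BijD(1)[OF L] by blast
  have "map (g i) (col i) = map (g' j) (col j)" if ij: "i \<in> \<Delta>" "j \<in> \<Delta>" "h i = h' j" for i j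
  proof (rule nth_equalityI)
    show "length (map (g i) (col i)) = length (map (g' j) (col j))"
      using col ij by (simp add: tuples_def)
    fix t assume "t < length (map (g i) (col i))"
    then have t: "t < m" using col ij by (simp add: tuples_def)
    have "product_perm \<Gamma> \<Delta> g h (row t) = f' (row t)" using e t by simp
    then have "product_perm \<Gamma> \<Delta> g h (row t) (h i) = product_perm \<Gamma> \<Delta> g' h' (row t) (h' j)"
      using gh'(1) ij(3) by simp
    then have "g i (row t i) = g' j (row t j)"
      unfolding product_perm_at_image[OF h row[OF t] ij(1)]
        product_perm_at_image[OF h' row[OF t] ij(2)] .
    then show "map (g i) (col i) ! t = map (g' j) (col j) ! t"
      using t col ij by (simp add: tuples_def row_def)
  qed
  then show thesis using that[OF gh'(3)] gh'(2) by blast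
qed

section \<open>The closure of the product action\<close>

lemma closure_isometry:
  assumes K: "subgroup K (BijGroup \<Gamma>)" and L: "subgroup L (BijGroup \<Delta>)" and m: "m \<ge> 2"
    and f: "f \<in> m_closure m (\<Delta> \<rightarrow>\<^sub>E \<Gamma>) (product_action \<Gamma> \<Delta> K L)"
    and u: "u \<in> \<Delta> \<rightarrow>\<^sub>E \<Gamma>" and v: "v \<in> \<Delta> \<rightarrow>\<^sub>E \<Gamma>"
  shows "card (disagreement \<Delta> (f u) (f v)) = card (disagreement \<Delta> u v)"
proof -
  let ?w = "u # replicate (m - 1) v"
  have "?w \<in> tuples m (\<Delta> \<rightarrow>\<^sub>E \<Gamma>)" using u v m by (auto simp: tuples_def)
  then obtain f' where f': "f' \<in> product_action \<Gamma> \<Delta> K L" and e: "map f ?w = map f' ?w"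
    using f m_closure_eq(1)[OF product_action_subgroup[OF K L]] by blast
  obtain g' h' where gh': "f' = product_perm \<Gamma> \<Delta> g' h'" "g' \<in> \<Delta> \<rightarrow> K" "h' \<in> L"
    using f' by (auto simp: product_action_def)
  have "g' \<in> \<Delta> \<rightarrow> Bij \<Gamma>" "h' \<in> Bij \<Delta>"
    using gh' subgroup_BijD(1)[OF K] subgroup_BijD(1)[OF L] by auto
  moreover have "f u = f' u" "f v = f' v" using e m by simp_all
  ultimately show ?thesis using product_perm_isometry[OF _ _ u v] gh'(1) by metis
qed

theorem theorem1p2:
  fixes \<Gamma> :: "'a set" and \<Delta> :: "'b set"
    and K :: "('a \<Rightarrow> 'a) set" and L :: "('b \<Rightarrow> 'b) set" and m :: nat
  assumes "finite \<Gamma>" and "\<Gamma> \<noteq> {}"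
    and "finite \<Delta>" and "\<Delta> \<noteq> {}"
    and "subgroup K (BijGroup \<Gamma>)"
    and "subgroup L (BijGroup \<Delta>)"
    and "m \<ge> 2"
    and "\<not> (m = 2 \<and> two_transitive \<Gamma> K)"
  shows "m_closure m (\<Delta> \<rightarrow>\<^sub>E \<Gamma>) (product_action \<Gamma> \<Delta> K L)
           \<subseteq> product_action \<Gamma> \<Delta> (m_closure m \<Gamma> K) (m_closure m \<Delta> L)"
proof
  let ?P = "\<Delta> \<rightarrow>\<^sub>E \<Gamma>" and ?Km = "m_closure m \<Gamma> K" and ?Lm = "m_closure m \<Delta> L"
  note K = assms(5) and L = assms(6)
  fix f assume f: "f \<in> m_closure m ?P (product_action \<Gamma> \<Delta> K L)"
  then have fB: "f \<in> Bij ?P"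
    using m_closure_eq(1)[OF product_action_subgroup[OF K L]] by blast
  obtain a where a: "a \<in> \<Gamma>" using assms(2) by blast
  show "f \<in> product_action \<Gamma> \<Delta> ?Km ?Lm"
  proof (cases "\<Gamma> = {a}")
    case True
    have eq: "u = v" if "u \<in> ?P" "v \<in> ?P" for u v
      using that True by (intro PiE_ext[OF that]) (auto simp: PiE_iff)
    have "f = (\<lambda>u\<in>?P. u)"
    proof (rule extensionalityI)
      show "f \<in> extensional ?P" using fB by (simp add: Bij_def)
      show "f u = (\<lambda>u\<in>?P. u) u" if "u \<in> ?P" for u
        using eq[OF Bij_apply[OF fB that] that] that by (simp only: restrict_apply')
    qed (rule restrict_extensional)
    then show ?thesis
      using subgroup_BijD(2)[OF product_action_subgroup[OF m_closure_eq(2)[OF K]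
        m_closure_eq(2)[OF L]]] by metis
  next
    case False
    then obtain b where b: "b \<in> \<Gamma>" "a \<noteq> b" using a by blast
    obtain g h where g: "g \<in> \<Delta> \<rightarrow> Bij \<Gamma>" and h: "h \<in> Bij \<Delta>"
      and fgh: "f = product_perm \<Gamma> \<Delta> g h"
      using hamming_isometry_product_perm[OF assms(1,3) a b fB
        closure_isometry[OF K L assms(7) f]] by metis
    note columns = closure_columns[OF L K h f[unfolded fgh]]
    have gK: "\<exists>k\<in>K. map (g i) xs = map k xs" if i: "i \<in> \<Delta>" and xs: "xs \<in> tuples m \<Gamma>" for i xs
    proof -
      obtain h' where h': "h' \<in> L"
        "\<And>i j. i \<in> \<Delta> \<Longrightarrow> j \<in> \<Delta> \<Longrightarrow> h i = h' j \<Longrightarrow> \<exists>k\<in>K. map (g i) xs = map k xs"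
        using columns[of "\<lambda>_. xs"] xs by metis
      have "h' \<in> Bij \<Delta>" using h'(1) subgroup_BijD(1)[OF L] by blast
      then have "inv_into \<Delta> h' (h i) \<in> \<Delta>" "h' (inv_into \<Delta> h' (h i)) = h i"
        using i h by (simp_all add: Bij_apply Bij_inv Bij_inv_into_mem)
      then show ?thesis using h'(2)[OF i] by metis
    qed
    then have g': "g \<in> \<Delta> \<rightarrow> ?Km" using g unfolding m_closure_eq(1)[OF K] by blast
    obtain c where c: "\<And>s. s \<le> m \<Longrightarrow> c s \<in> tuples m \<Gamma>"
      and sep: "\<And>s t k k'. s \<le> m \<Longrightarrow> t \<le> m \<Longrightarrow> k \<in> K \<Longrightarrow> k' \<in> K \<Longrightarrow>
        map k (c s) = map k' (c t) \<Longrightarrow> s = t"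
      using ex_inequivalent_tuples[OF K a b assms(7,8)] by metis
    have "\<exists>h'\<in>L. map h is = map h' is" if "is": "is \<in> tuples m \<Delta>" for "is"
    proof -
      \<comment> \<open>A listed coordinate gets the column numbered by its first occurrence, so that repetitions
        in the list do no harm; all other coordinates share the spare column \<open>c m\<close>.\<close>
      define pos where "pos = (\<lambda>i. length (takeWhile (\<lambda>j. j \<noteq> i) is))"
      have len: "length is = m" and sub: "set is \<subseteq> \<Delta>" using "is" by (auto simp: tuples_def)
      have pos_le: "pos i \<le> m" for i using length_takeWhile_le len unfolding pos_def by metis
      have pos_nth: "is ! pos i = i" if "pos i < m" for i
        using nth_length_takeWhile[of "\<lambda>j. j \<noteq> i" "is"] that len by (simp add: pos_def)
      have pos_less: "pos i < m" if i: "i \<in> set is" for i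
      proof (rule ccontr)
        assume "\<not> pos i < m"
        then have "take (pos i) is = is" using len by simp
        then have "takeWhile (\<lambda>j. j \<noteq> i) is = is"
          unfolding pos_def takeWhile_eq_take[symmetric] .
        then have "\<forall>j\<in>set is. j \<noteq> i" unfolding takeWhile_eq_all_conv .
        then show False using i by blast
      qed
      obtain h' where h': "h' \<in> L"
        "\<And>i j. i \<in> \<Delta> \<Longrightarrow> j \<in> \<Delta> \<Longrightarrow> h i = h' j \<Longrightarrow>
          \<exists>k\<in>K. map (g i) (c (pos i)) = map k (c (pos j))"
        using columns[of "\<lambda>i. c (pos i)"] c pos_le by metis
      have h'B: "h' \<in> Bij \<Delta>" using h'(1) subgroup_BijD(1)[OF L] by blast
      have "h i = h' i" if i: "i \<in> set is" for i
      proof -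
        have iD: "i \<in> \<Delta>" using i sub by blast
        define j where "j = inv_into \<Delta> h' (h i)"
        have j: "j \<in> \<Delta>" "h i = h' j"
          using iD h h'B by (simp_all add: j_def Bij_apply Bij_inv Bij_inv_into_mem)
        obtain k where k: "k \<in> K" "map (g i) (c (pos i)) = map k (c (pos j))"
          using h'(2)[OF iD j] by blast
        obtain k' where k': "k' \<in> K" "map (g i) (c (pos i)) = map k' (c (pos i))"
          using gK[OF iD c[OF pos_le]] by blast
        have "pos i = pos j" using sep[OF pos_le pos_le k'(1) k(1)] k(2) k'(2) by metis
        then have "i = j" using pos_nth pos_less[OF i] by metis
        then show ?thesis using j by simp
      qed
      then have "map h is = map h' is" by simp
      then show ?thesis using h'(1) by blast
    qed
    then have h': "h \<in> ?Lm" using h unfolding m_closure_eq(1)[OF L] by blast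
    show ?thesis using g' h' fgh by (auto simp: product_action_def)
  qed
qed

end
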